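(* Let $A=\{\mathbf a_1,\dots,\mathbf a_n\}\subset\mathbb Z^d$ be a finite set generating $\mathbb Z^d$ as a lattice, let $Q$ be the semigroup generated by $A$, and let $K=\mathrm{cone}(A)$, assumed pointed with non-empty interior. A face $F$ of $K$ is nowhere saturated if and only if there exists a $Q$-minimal saturation point $\mathbf y$ such that every point of $\mathbf y+Q_F$ is an $S$-minimal saturation point.
   Context: $Q=\{\sum_i\lambda_i\mathbf a_i:\lambda_i\in\mathbb N\}$, $K=\{\sum_i\lambda_i\mathbf a_i:\lambda_i\in\mathbb R_{\ge0}\}$, $Q_{\rm sat}=K\cap\mathbb Z^d$. A point $\mathbf a\in Q$ is a saturation point if $\mathbf a+Q_{\rm sat}\subset Q$; $S$ is the set of saturation points. A saturation point $\mathbf a$ is $S$-minimal if there is no $\mathbf s\in S$ with $\mathbf a-\mathbf s\in S$ (i.e. $\{\mathbf a-\mathbf s:\mathbf s\in S\cup\{0\}\}\cap S=\{\mathbf a\}$). A saturation point $\mathbf a$ is $Q$-minimal if $\{\mathbf a-\mathbf q:\mathbf q\in Q\}\cap S=\{\mathbf a\}$. For a face $F$ of $K$, $Q_F=Q\cap F$ and $\mathbf y+Q_F=\{\mathbf y+\mathbf a:\mathbf a\in Q_F\}$. A face $F$ is almost saturated if it contains a saturation point of $Q$, and nowhere saturated otherwise. *)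

theory Defs
  imports "HOL-Analysis.Analysis"
begin

definition int_points :: "(real ^ 'd) set" where
  "int_points = {x. \<forall>i. x $ i \<in> \<int>}"

definition lattice_gen :: "(real ^ 'd) set \<Rightarrow> (real ^ 'd) set" where
  "lattice_gen A = {\<Sum>a\<in>A. of_int (l a) *\<^sub>R a | l :: real ^ 'd \<Rightarrow> int. True}"

definition semigroup_gen :: "(real ^ 'd) set \<Rightarrow> (real ^ 'd) set" where
  "semigroup_gen A = {\<Sum>a\<in>A. of_nat (l a) *\<^sub>R a | l :: real ^ 'd \<Rightarrow> nat. True}"

definition cone_gen :: "(real ^ 'd) set \<Rightarrow> (real ^ 'd) set" where
  "cone_gen A = {\<Sum>a\<in>A. l a *\<^sub>R a | l :: real ^ 'd \<Rightarrow> real. \<forall>a\<in>A. 0 \<le> l a}"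

definition pointed :: "(real ^ 'd) set \<Rightarrow> bool" where
  "pointed K \<longleftrightarrow> K \<inter> uminus ` K = {0}"

definition saturation :: "(real ^ 'd) set \<Rightarrow> (real ^ 'd) set" where
  "saturation A = cone_gen A \<inter> int_points"

definition saturation_points :: "(real ^ 'd) set \<Rightarrow> (real ^ 'd) set" where
  "saturation_points A =
    {a \<in> semigroup_gen A. (\<lambda>x. a + x) ` saturation A \<subseteq> semigroup_gen A}"

text \<open>
  Write \<open>Q\<close> for \<open>semigroup_gen A\<close> and \<open>S\<close> for \<open>saturation_points A\<close>. The condition below agrees with
  \<open>{a - s | s. s \<in> S \<union> {0}} \<inter> S = {a}\<close> whenever \<open>0 \<notin> S\<close>, that is, whenever \<open>Q\<close> is not
  saturated. If \<open>0 \<in> S\<close>, no point is \<open>S\<close>-minimal in the present sense, since \<open>a - 0 \<in> S\<close>,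
  whereas the set equation would still admit \<open>a = 0\<close>.
\<close>

definition S_minimal :: "(real ^ 'd) set \<Rightarrow> real ^ 'd \<Rightarrow> bool" where
  "S_minimal A a \<longleftrightarrow>
    a \<in> saturation_points A \<and>
    \<not> (\<exists>s\<in>saturation_points A. a - s \<in> saturation_points A)"

definition Q_minimal :: "(real ^ 'd) set \<Rightarrow> real ^ 'd \<Rightarrow> bool" where
  "Q_minimal A a \<longleftrightarrow>
    a \<in> saturation_points A \<and>
    {a - q | q. q \<in> semigroup_gen A} \<inter> saturation_points A = {a}"

definition almost_saturated :: "(real ^ 'd) set \<Rightarrow> (real ^ 'd) set \<Rightarrow> bool" where
  "almost_saturated A F \<longleftrightarrow> (\<exists>a\<in>F. a \<in> saturation_points A)"

definition nowhere_saturated :: "(real ^ 'd) set \<Rightarrow> (real ^ 'd) set \<Rightarrow> bool" where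
  "nowhere_saturated A F \<longleftrightarrow> \<not> almost_saturated A F"

end

(*
  Expose F by a linear functional g that is nonnegative on the cone and vanishes exactly on F.
  If F is nowhere saturated, then g > 0 on S, and since the nonzero values of g on Q are bounded
  away from 0, its infimum m over S is positive. Choose a saturation point with g < 2 m and descend to a Q-minimal
  point y below it. Translating y by Q_F leaves g unchanged, whereas a sum of two saturation points
  has g at least 2 m. Conversely, if s is a saturation point in F, then y + s is never S-minimal.
*)

theory Submission
  imports Defs
begin

section \<open>Lattice points\<close>

lemma int_points_diff: "x \<in> int_points \<Longrightarrow> y \<in> int_points \<Longrightarrow> x - y \<in> int_points"
  by (simp add: int_points_def)

lemma int_combination_in_int_points:
  assumes "A \<subseteq> int_points"
  shows "(\<Sum>a\<in>A. of_int (l a) *\<^sub>R a) \<in> int_points"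
  using assms by (auto simp: int_points_def intro!: Ints_sum Ints_mult)

text \<open>Each coordinate is bounded by the norm, so only finitely many integers are available for
  each of the finitely many coordinates.\<close>

lemma finite_int_points_cball: "finite (int_points \<inter> cball 0 B :: (real ^ 'd) set)"
proof -
  let ?I = "{k :: real. k \<in> \<int> \<and> \<bar>k\<bar> \<le> B}"
  have "int_points \<inter> cball 0 B \<subseteq> vec_lambda ` {f :: 'd \<Rightarrow> real. \<forall>i. f i \<in> ?I}"
  proof
    fix x :: "real ^ 'd"
    assume x: "x \<in> int_points \<inter> cball 0 B"
    then have "x $ i \<in> ?I" for i
      using component_le_norm_cart[of x i] by (auto simp: int_points_def)
    then have "vec_nth x \<in> {f. \<forall>i. f i \<in> ?I}" by blast
    then show "x \<in> vec_lambda ` {f. \<forall>i. f i \<in> ?I}"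
      by (metis (no_types, lifting) image_eqI vec_nth_inverse)
  qed
  moreover have "finite {f :: 'd \<Rightarrow> real. \<forall>i. f i \<in> ?I}"
  proof -
    have "{f :: 'd \<Rightarrow> real. \<forall>i. f i \<in> ?I} = (\<Pi>\<^sub>E i\<in>UNIV. ?I)"
      by (auto simp: PiE_def)
    then show ?thesis
      using finite_abs_int_segment[of B] by (simp add: finite_PiE)
  qed
  ultimately show ?thesis
    by (meson finite_imageI finite_subset)
qed

section \<open>The semigroup and the cone generated by \<open>A\<close>\<close>

lemma semigroup_genI: "x = (\<Sum>a\<in>A. of_nat (l a) *\<^sub>R a) \<Longrightarrow> x \<in> semigroup_gen A"
  by (auto simp: semigroup_gen_def)

lemma semigroup_genI_int:
  assumes "x = (\<Sum>a\<in>A. of_int (l a) *\<^sub>R a)" and "\<And>a. a \<in> A \<Longrightarrow> 0 \<le> l a"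
  shows "x \<in> semigroup_gen A"
  by (rule semigroup_genI[where l = "\<lambda>a. nat (l a)"]) (auto simp: assms intro!: sum.cong)

lemma zero_in_semigroup_gen: "0 \<in> semigroup_gen A"
  by (rule semigroup_genI[where l = "\<lambda>_. 0"]) simp

lemma semigroup_gen_add:
  assumes "x \<in> semigroup_gen A" and "y \<in> semigroup_gen A"
  shows "x + y \<in> semigroup_gen A"
proof -
  obtain l m :: "real ^ 'a \<Rightarrow> nat"
    where "x = (\<Sum>a\<in>A. of_nat (l a) *\<^sub>R a)" "y = (\<Sum>a\<in>A. of_nat (m a) *\<^sub>R a)"
    using assms by (auto simp: semigroup_gen_def)
  then show ?thesis
    by (intro semigroup_genI[where l = "\<lambda>a. l a + m a"]) (simp add: sum.distrib scaleR_left_distrib)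
qed

lemma semigroup_gen_subset_cone_gen: "semigroup_gen A \<subseteq> cone_gen A"
  unfolding semigroup_gen_def cone_gen_def
  by clarify (metis of_nat_0_le_iff)

lemma convex_cone_cone_gen: "convex_cone (cone_gen A)"
  unfolding convex_cone_iff
proof (intro conjI ballI allI impI)
  show "0 \<in> cone_gen A"
    using semigroup_gen_subset_cone_gen zero_in_semigroup_gen by blast
next
  fix x y assume "x \<in> cone_gen A" "y \<in> cone_gen A"
  then obtain l m where "\<forall>a\<in>A. 0 \<le> l a" "\<forall>a\<in>A. 0 \<le> m a"
    "x = (\<Sum>a\<in>A. l a *\<^sub>R a)" "y = (\<Sum>a\<in>A. m a *\<^sub>R a)"
    by (auto simp: cone_gen_def)
  then show "x + y \<in> cone_gen A"
    unfolding cone_gen_def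
    by (auto intro!: exI[of _ "\<lambda>a. l a + m a"] simp: sum.distrib scaleR_left_distrib)
next
  fix x and c :: real assume "x \<in> cone_gen A" "0 \<le> c"
  then obtain l where "\<forall>a\<in>A. 0 \<le> l a" "x = (\<Sum>a\<in>A. l a *\<^sub>R a)"
    by (auto simp: cone_gen_def)
  with \<open>0 \<le> c\<close> show "c *\<^sub>R x \<in> cone_gen A"
    unfolding cone_gen_def
    by (auto intro!: exI[of _ "\<lambda>a. c * l a"] simp: scaleR_sum_right)
qed

lemma generators_subset_semigroup_gen:
  assumes "finite A"
  shows "A \<subseteq> semigroup_gen A"
proof
  fix b assume "b \<in> A"
  have "(\<Sum>a\<in>A. of_nat (if a = b then 1 else 0) *\<^sub>R a) = (\<Sum>a\<in>A. if a = b then a else 0)"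
    by (intro sum.cong) auto
  then show "b \<in> semigroup_gen A"
    using assms \<open>b \<in> A\<close>
    by (intro semigroup_genI[where l = "\<lambda>a. if a = b then 1 else 0"]) (simp add: sum.delta)
qed

text \<open>Links the coefficient description of the cone to the hull, which is a polyhedron when
  \<open>A\<close> is finite.\<close>

lemma cone_gen_eq_convex_cone_hull:
  assumes "finite A"
  shows "cone_gen A = convex_cone hull A"
proof
  have "(\<Sum>a\<in>A. l a *\<^sub>R a) \<in> convex_cone hull A" if "\<forall>a\<in>A. 0 \<le> l a" for l :: "real ^ 'a \<Rightarrow> real"
  proof -
    have "(\<Sum>a\<in>B. l a *\<^sub>R a) \<in> convex_cone hull A" if "finite B" "B \<subseteq> A" for B
      using that \<open>\<forall>a\<in>A. 0 \<le> l a\<close>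
      by induction (auto intro!: convex_cone_hull_contains_0 convex_cone_hull_add
          convex_cone_hull_mul simp: hull_inc)
    then show ?thesis
      using assms by simp
  qed
  then show "cone_gen A \<subseteq> convex_cone hull A"
    by (auto simp: cone_gen_def)
  show "convex_cone hull A \<subseteq> cone_gen A"
    using assms generators_subset_semigroup_gen semigroup_gen_subset_cone_gen convex_cone_cone_gen
    by (intro hull_minimal) blast+
qed

section \<open>Faces and supporting functionals\<close>

text \<open>A finitely generated cone is a polyhedron, so its faces are exposed. A supporting
  hyperplane that meets the cone must pass through the origin, because the cone is closed under
  scaling.\<close>

lemma face_of_cone_gen_exposed:
  assumes "finite A" and "F face_of cone_gen A" and "F \<noteq> {}"
  obtains g where "\<And>x. x \<in> cone_gen A \<Longrightarrow> 0 \<le> g \<bullet> x" and "F = {x \<in> cone_gen A. g \<bullet> x = 0}"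
proof -
  let ?K = "cone_gen A"
  have "polyhedron ?K"
    using assms by (simp add: cone_gen_eq_convex_cone_hull polyhedron_convex_cone_hull)
  then have "F exposed_face_of ?K"
    using assms by (simp add: exposed_face_of_polyhedron)
  then obtain h b where le: "\<And>x. x \<in> ?K \<Longrightarrow> h \<bullet> x \<le> b" and F: "F = {x \<in> ?K. h \<bullet> x = b}"
    unfolding exposed_face_of_def by blast
  obtain x where x: "x \<in> ?K" "h \<bullet> x = b"
    using F assms by blast
  \<comment> \<open>The origin gives \<open>0 \<le> b\<close>, and doubling a point of the face
    gives \<open>2 * b \<le> b\<close>.\<close>
  have "0 \<in> ?K" and "2 *\<^sub>R x \<in> ?K"
    using convex_cone_cone_gen[of A] x by (simp_all add: convex_cone_iff)
  then have "b = 0"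
    using le[of 0] le[of "2 *\<^sub>R x"] x by simp
  then show thesis
    using le F by (intro that[of "- h"]) auto
qed

text \<open>Exposing this face of the cone over a finite \<open>A\<close> yields a functional that
  is positive on all other points of the cone. It serves as a height for the descent to Q-minimal
  points.\<close>

lemma zero_face_of_pointed_cone:
  assumes "pointed K" and "convex_cone K"
  shows "{0} face_of K"
  unfolding face_of_singleton extreme_point_of_def
proof (intro conjI ballI)
  show "0 \<in> K"
    using assms convex_cone_contains_0 by blast
  fix x y assume xy: "x \<in> K" "y \<in> K"
  show "0 \<notin> open_segment x y"
  proof
    assume "0 \<in> open_segment x y"
    then obtain u where u: "0 < u" "u < 1" "x \<noteq> y" "0 = (1 - u) *\<^sub>R x + u *\<^sub>R y"
      by (auto simp: in_segment)
    \<comment> \<open>The two summands lie in the cone and are negatives of each other, so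
      pointedness forces both to vanish.\<close>
    have eq: "u *\<^sub>R y = - ((1 - u) *\<^sub>R x)"
      using u(4) by (simp add: eq_neg_iff_add_eq_0 add.commute)
    have K: "(1 - u) *\<^sub>R x \<in> K" "u *\<^sub>R y \<in> K"
      using xy u assms(2) by (auto intro!: convex_cone_scaleR)
    then have "u *\<^sub>R y \<in> K \<inter> uminus ` K"
      using eq by auto
    then have "u *\<^sub>R y = 0"
      using assms(1) unfolding pointed_def by blast
    then have "y = 0" and "x = 0"
      using u(1,2) eq by simp_all
    then show False
      using u(3) by simp
  qed
qed

text \<open>Contributions of the generators are nonnegative and cannot cancel. A single generator
  with nonzero coefficient and positive value of \<open>g\<close> already contributes at least the
  least positive value on \<open>A\<close>.\<close>

lemma inner_semigroup_gen_gap: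
  assumes "finite A" and nonneg: "\<And>a. a \<in> A \<Longrightarrow> 0 \<le> g \<bullet> a"
  obtains c where "0 < c" and "\<And>q. q \<in> semigroup_gen A \<Longrightarrow> g \<bullet> q = 0 \<or> c \<le> g \<bullet> q"
proof
  \<comment> \<open>The extra \<open>1\<close> keeps the set nonempty when \<open>g\<close> vanishes
    on all of \<open>A\<close>.\<close>
  define P where "P = insert 1 ((\<lambda>a. g \<bullet> a) ` {a \<in> A. 0 < g \<bullet> a})"
  have fin: "finite P"
    using assms by (simp add: P_def)
  then show "0 < Min P"
    by (subst Min_gr_iff) (auto simp: P_def)
  fix q assume "q \<in> semigroup_gen A"
  then obtain l :: "real ^ 'a \<Rightarrow> nat" where q: "q = (\<Sum>a\<in>A. of_nat (l a) *\<^sub>R a)"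
    by (auto simp: semigroup_gen_def)
  have gq: "g \<bullet> q = (\<Sum>a\<in>A. real (l a) * (g \<bullet> a))"
    by (simp add: q inner_sum_right)
  show "g \<bullet> q = 0 \<or> Min P \<le> g \<bullet> q"
  proof (cases "\<exists>a\<in>A. l a \<noteq> 0 \<and> g \<bullet> a \<noteq> 0")
    case True
    then obtain a where a: "a \<in> A" "l a \<noteq> 0" "0 < g \<bullet> a"
      using nonneg by (metis less_eq_real_def)
    have "Min P \<le> g \<bullet> a"
      using fin a by (intro Min_le) (auto simp: P_def)
    also have "\<dots> \<le> real (l a) * (g \<bullet> a)"
      using a by (simp add: Suc_le_eq)
    also have "\<dots> \<le> g \<bullet> q"
      unfolding gq using assms a by (intro member_le_sum) auto
    finally show ?thesis ..
  next
    case False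
    then show ?thesis
      unfolding gq by (auto intro!: sum.neutral)
  qed
qed

section \<open>Existence of saturation points\<close>

text \<open>Taking floors of its cone coefficients splits a point of \<open>saturation A\<close>
  into an element of Q and a bounded lattice remainder. Only finitely many remainders occur, so one
  element \<open>s\<close> of Q with large coefficients compensates the negative coefficients in
  integer representations of all of them.\<close>

lemma saturation_points_nonempty:
  fixes A :: "(real ^ 'd) set"
  assumes "finite A" and "A \<subseteq> int_points" and "lattice_gen A = int_points"
  shows "saturation_points A \<noteq> {}"
proof -
  \<comment> \<open>The radius bounds every combination of generators whose coefficients are
    fractional parts.\<close>
  define R :: "(real ^ 'd) set" where "R = int_points \<inter> cball 0 (\<Sum>a\<in>A. norm a)"
  have finR: "finite R"
    by (simp add: R_def finite_int_points_cball)
  have "\<forall>r\<in>int_points. \<exists>l :: real ^ 'd \<Rightarrow> int. r = (\<Sum>a\<in>A. of_int (l a) *\<^sub>R a)"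
    using assms(3) by (auto simp: lattice_gen_def)
  then obtain L :: "real ^ 'd \<Rightarrow> real ^ 'd \<Rightarrow> int"
    where L: "\<And>r. r \<in> int_points \<Longrightarrow> r = (\<Sum>a\<in>A. of_int (L r a) *\<^sub>R a)"
    by metis
  \<comment> \<open>The sum of absolute values dominates \<open>- L r a\<close> for all remainders
    \<open>r\<close> in \<open>R\<close> at once.\<close>
  define N where "N a = (\<Sum>r\<in>R. \<bar>L r a\<bar>)" for a
  have N: "0 \<le> N a" for a
    by (simp add: N_def sum_nonneg)
  have NL: "0 \<le> N a + L r a" if "r \<in> R" for r a
    using member_le_sum[OF that, of "\<lambda>r. \<bar>L r a\<bar>"] finR by (simp add: N_def)
  define s where "s = (\<Sum>a\<in>A. of_int (N a) *\<^sub>R a)"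
  have "s \<in> semigroup_gen A"
    using N by (intro semigroup_genI_int[OF s_def])
  moreover have "s + x \<in> semigroup_gen A" if "x \<in> saturation A" for x
  proof -
    obtain t where t: "\<forall>a\<in>A. 0 \<le> t a" and x: "x = (\<Sum>a\<in>A. t a *\<^sub>R a)"
      using \<open>x \<in> saturation A\<close> by (auto simp: saturation_def cone_gen_def)
    define r where "r = (\<Sum>a\<in>A. frac (t a) *\<^sub>R a)"
    have r: "r = x - (\<Sum>a\<in>A. of_int \<lfloor>t a\<rfloor> *\<^sub>R a)"
      by (simp add: r_def x frac_def scaleR_left_diff_distrib sum_subtractf)
    have "r \<in> int_points"
      unfolding r using that assms(2)
      by (intro int_points_diff int_combination_in_int_points) (auto simp: saturation_def)
    moreover have "norm r \<le> (\<Sum>a\<in>A. norm a)"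
      unfolding r_def
      by (rule sum_norm_le) (auto intro!: mult_left_le_one_le simp: frac_lt_1 less_imp_le)
    ultimately have "r \<in> R"
      by (simp add: R_def)
    have "x = (\<Sum>a\<in>A. of_int (L r a) *\<^sub>R a) + (\<Sum>a\<in>A. of_int \<lfloor>t a\<rfloor> *\<^sub>R a)"
      using L[OF \<open>r \<in> int_points\<close>] r by simp
    then have "s + x = (\<Sum>a\<in>A. of_int (N a + L r a + \<lfloor>t a\<rfloor>) *\<^sub>R a)"
      by (simp add: s_def scaleR_left_distrib sum.distrib)
    then show ?thesis
      by (rule semigroup_genI_int) (use NL[OF \<open>r \<in> R\<close>] t in auto)
  qed
  ultimately show ?thesis
    by (auto simp: saturation_points_def)
qed

section \<open>Translation and descent within the saturation points\<close>

lemma saturation_points_add_semigroup_gen: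
  assumes "y \<in> saturation_points A" and "q \<in> semigroup_gen A"
  shows "y + q \<in> saturation_points A"
proof -
  have "y + q + x \<in> semigroup_gen A" if "x \<in> saturation A" for x
  proof -
    have "y + x \<in> semigroup_gen A"
      using assms(1) that by (auto simp: saturation_points_def)
    then have "(y + x) + q \<in> semigroup_gen A"
      using assms(2) by (rule semigroup_gen_add)
    then show ?thesis
      by (simp add: ac_simps)
  qed
  then show ?thesis
    using assms by (auto simp: saturation_points_def intro: semigroup_gen_add)
qed

text \<open>A functional positive away from the origin has a gap \<open>c\<close> on Q. Among the
  saturation points below \<open>z\<close>, one whose value is within \<open>c\<close> of the
  infimum is Q-minimal: subtracting a nonzero element of Q would lower the value by at least
  \<open>c\<close>, past the infimum.\<close>

lemma Q_minimal_below:
  assumes "finite A" and "pointed (cone_gen A)" and z: "z \<in> saturation_points A"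
  obtains y where "Q_minimal A y" and "z - y \<in> semigroup_gen A"
proof -
  obtain g where g: "\<And>x. x \<in> cone_gen A \<Longrightarrow> 0 \<le> g \<bullet> x" "{0} = {x \<in> cone_gen A. g \<bullet> x = 0}"
    using face_of_cone_gen_exposed[OF assms(1) zero_face_of_pointed_cone[OF assms(2) convex_cone_cone_gen]]
    by blast
  have QK: "q \<in> cone_gen A" if "q \<in> semigroup_gen A" for q
    using that semigroup_gen_subset_cone_gen by blast
  obtain c where c: "0 < c" "\<And>q. q \<in> semigroup_gen A \<Longrightarrow> g \<bullet> q = 0 \<or> c \<le> g \<bullet> q"
    using inner_semigroup_gen_gap[OF assms(1), of g] g QK generators_subset_semigroup_gen[OF assms(1)]
    by blast
  define T where "T = {y \<in> saturation_points A. z - y \<in> semigroup_gen A}"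
  have "z \<in> T"
    using z by (simp add: T_def zero_in_semigroup_gen)
  have bdd: "bdd_below ((\<lambda>y. g \<bullet> y) ` T)"
    using g QK by (intro bdd_belowI[of _ 0]) (auto simp: T_def saturation_points_def)
  obtain y where y: "y \<in> T" "g \<bullet> y < Inf ((\<lambda>y. g \<bullet> y) ` T) + c"
    using cInf_lessD[of "(\<lambda>y. g \<bullet> y) ` T" "Inf ((\<lambda>y. g \<bullet> y) ` T) + c"] c \<open>z \<in> T\<close> by auto
  have "q = 0" if q: "q \<in> semigroup_gen A" "y - q \<in> saturation_points A" for q
  proof -
    have "z - y + q \<in> semigroup_gen A"
      using y q by (simp add: T_def semigroup_gen_add)
    then have "y - q \<in> T"
      using q by (simp add: T_def algebra_simps)
    then have "Inf ((\<lambda>y. g \<bullet> y) ` T) \<le> g \<bullet> (y - q)"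
      using bdd by (intro cInf_lower) auto
    then have "g \<bullet> q = 0"
      using c(2)[OF q(1)] y by (auto simp: inner_diff_right)
    then show "q = 0"
      using g(2) QK q(1) by blast
  qed
  then have "{y - q | q. q \<in> semigroup_gen A} \<inter> saturation_points A = {y}"
    using y(1) zero_in_semigroup_gen[of A] by (force simp: T_def)
  then show thesis
    using y(1) by (intro that[of y]) (auto simp: Q_minimal_def T_def)
qed

section \<open>Translates along a nowhere saturated face\<close>

lemma exists_S_minimal_translate_if_nowhere_saturated:
  fixes A F :: "(real ^ 'd) set"
  assumes "finite A" and "A \<subseteq> int_points" and "lattice_gen A = int_points"
    and "pointed (cone_gen A)" and "F face_of cone_gen A" and nowhere: "nowhere_saturated A F"
  shows "\<exists>y. Q_minimal A y \<and> (\<forall>a \<in> semigroup_gen A \<inter> F. S_minimal A (y + a))"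
proof -
  obtain s0 where s0: "s0 \<in> saturation_points A"
    using saturation_points_nonempty assms by blast
  show ?thesis
  \<comment> \<open>The empty set also counts as a face. The condition on translates is then
    vacuous, but a Q-minimal point must still be found.\<close>
  proof (cases "F = {}")
    case True
    then show ?thesis
      using Q_minimal_below[OF assms(1,4) s0] by auto
  next
    case False
    obtain g where g: "\<And>x. x \<in> cone_gen A \<Longrightarrow> 0 \<le> g \<bullet> x" "F = {x \<in> cone_gen A. g \<bullet> x = 0}"
      using face_of_cone_gen_exposed[OF assms(1,5) False] by blast
    have QK: "q \<in> cone_gen A" if "q \<in> semigroup_gen A" for q
      using that semigroup_gen_subset_cone_gen by blast
    obtain c where c: "0 < c" "\<And>q. q \<in> semigroup_gen A \<Longrightarrow> g \<bullet> q = 0 \<or> c \<le> g \<bullet> q"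
      using inner_semigroup_gen_gap[OF assms(1), of g] g QK generators_subset_semigroup_gen[OF assms(1)]
      by blast
    let ?S = "saturation_points A"
    define m where "m = Inf ((\<lambda>s. g \<bullet> s) ` ?S)"
    \<comment> \<open>A saturation point with value \<open>0\<close> would lie in \<open>F\<close>,
      so only the second alternative of the gap remains.\<close>
    have gS: "c \<le> g \<bullet> s" if "s \<in> ?S" for s
      using that c(2)[of s] nowhere g(2) QK
      by (auto simp: nowhere_saturated_def almost_saturated_def saturation_points_def)
    have m_le: "m \<le> g \<bullet> s" if "s \<in> ?S" for s
      unfolding m_def using that gS by (intro cInf_lower bdd_belowI[of _ c]) auto
    have "c \<le> m"
      unfolding m_def using s0 gS by (intro cInf_greatest) auto
    \<comment> \<open>Positivity of \<open>m\<close> gives \<open>m < 2 * m\<close>, so the infimum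
      is undercut by \<open>2 * m\<close>.\<close>
    then obtain z where z: "z \<in> ?S" "g \<bullet> z < 2 * m"
      using cInf_lessD[of "(\<lambda>s. g \<bullet> s) ` ?S" "2 * m"] c s0 by (auto simp: m_def)
    obtain y where y: "Q_minimal A y" "z - y \<in> semigroup_gen A"
      using Q_minimal_below[OF assms(1,4) z(1)] .
    have gy: "g \<bullet> y < 2 * m"
      using g(1)[OF QK[OF y(2)]] z by (simp add: inner_diff_right)
    have "S_minimal A (y + a)" if a: "a \<in> semigroup_gen A \<inter> F" for a
      unfolding S_minimal_def
    proof
      show "y + a \<in> ?S"
        using y(1) a by (simp add: Q_minimal_def saturation_points_add_semigroup_gen)
      have "g \<bullet> a = 0"
        using a g(2) by blast
      \<comment> \<open>Otherwise \<open>s\<close> and \<open>y + a - s\<close> each have value at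
        least \<open>m\<close>, while their sum has the value of \<open>y\<close>, which is below
        \<open>2 * m\<close>.\<close>
      then have "y + a - s \<notin> ?S" if "s \<in> ?S" for s
        using m_le[OF that] m_le[of "y + a - s"] gy
        by (auto simp: inner_diff_right inner_add_right)
      then show "\<not> (\<exists>s\<in>?S. y + a - s \<in> ?S)" by blast
    qed
    with y(1) show ?thesis by blast
  qed
qed

theorem theorem3p5:
  fixes A F :: "(real ^ 'd) set"
  assumes "finite A"
    and "A \<subseteq> int_points"
    and "lattice_gen A = int_points"
    and "pointed (cone_gen A)"
    and "interior (cone_gen A) \<noteq> {}"
    and "F face_of cone_gen A"
  shows "nowhere_saturated A F \<longleftrightarrow>
    (\<exists>y. Q_minimal A y \<and>
      (\<forall>x \<in> {y + a | a. a \<in> semigroup_gen A \<inter> F}. S_minimal A x))"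
proof
  assume "nowhere_saturated A F"
  then obtain y where "Q_minimal A y" "\<forall>a \<in> semigroup_gen A \<inter> F. S_minimal A (y + a)"
    using exists_S_minimal_translate_if_nowhere_saturated assms(1-4,6) by blast
  then show "\<exists>y. Q_minimal A y \<and>
      (\<forall>x \<in> {y + a | a. a \<in> semigroup_gen A \<inter> F}. S_minimal A x)"
    by blast
next
  assume "\<exists>y. Q_minimal A y \<and>
      (\<forall>x \<in> {y + a | a. a \<in> semigroup_gen A \<inter> F}. S_minimal A x)"
  then obtain y where y: "y \<in> saturation_points A"
    and min: "\<And>a. a \<in> semigroup_gen A \<inter> F \<Longrightarrow> S_minimal A (y + a)"
    by (auto simp: Q_minimal_def)
  have False if "s \<in> F" "s \<in> saturation_points A" for s
  proof -
    \<comment> \<open>Saturation points belong to Q, so \<open>s\<close> is an admissible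
      translation along \<open>F\<close>; subtracting it again leaves the saturation point
      \<open>y\<close>.\<close>
    have "S_minimal A (y + s)"
      using that by (intro min) (auto simp: saturation_points_def)
    moreover have "y + s - s \<in> saturation_points A"
      using y by simp
    ultimately show False
      using that(2) unfolding S_minimal_def by blast
  qed
  then show "nowhere_saturated A F"
    by (auto simp: nowhere_saturated_def almost_saturated_def)
qed

end
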